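(* None of the following classes of (isomorphism classes of) persistence modules is a set: the class $\mathrm{(id)}$ of interval-decomposable persistence modules, the class $\mathrm{(qtame)}$ of q-tame persistence modules, and the class $\mathrm{(pm)}$ of all persistence modules.
   Context: Fix a field $\mathbf{k}$. A persistence module is a functor $M:(\mathbb{R},\le)\to \mathrm{Vect}_{\mathbf{k}}$; persistence modules are considered up to isomorphism. For an interval $J\subset\mathbb{R}$, the interval module $J$ is $\mathbf{k}$ at points of $J$ and $0$ elsewhere, with identity maps between points of $J$ and zero maps otherwise. $M$ is interval-decomposable if it is isomorphic to $\bigoplus_{\alpha\in A}I_\alpha$ for some index set $A$ and interval modules $I_\alpha$; $M$ is q-tame if $M(a<b)$ has finite rank for all $a<b$. "Not a set" means a proper class. *)

theory Defs
  imports "HOL-Analysis.Topology_Euclidean_Space" "Jordan_Normal_Form.Missing_VectorSpace"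
begin

text \<open>
  Sets and proper classes.  HOL itself has no proper classes, so the ambient set theory is made
  explicit: \<open>'v\<close> is a universe of ZFC sets (in the style of the AFP entry \<open>ZFC_in_HOL\<close>, whose
  type \<open>V\<close> with its operation \<open>elts\<close> is a model), and every HOL set over \<open>'v\<close> is a class.  Choice
  is inherited from HOL; pairing follows from \<open>infinity\<close>.
\<close>

locale zfc_universe =
  fixes elts :: "'v \<Rightarrow> 'v set"
  assumes extensionality: "elts x = elts y \<Longrightarrow> x = y"
    and foundation: "wf {(x, y). x \<in> elts y}"
    and separation: "X \<subseteq> elts x \<Longrightarrow> \<exists>y. elts y = X"
    and union: "\<exists>y. elts y = (\<Union>z\<in>elts x. elts z)"
    and powerset: "\<exists>y. elts y = {z. elts z \<subseteq> elts x}"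
    and replacement: "\<exists>y. elts y = f ` elts x"
    and infinity: "\<exists>y. elts y = range (g :: nat \<Rightarrow> 'v)"

text \<open>
  A collection is a set, up to renaming of its members, if it is in bijection with the members of
  an element of the universe; otherwise it is a proper class.  Members of an arbitrary type are
  allowed because classes of isomorphism classes do not live in \<open>'v\<close>.
\<close>

definition small :: "('v \<Rightarrow> 'v set) \<Rightarrow> 'b set \<Rightarrow> bool" where
  "small elts X \<longleftrightarrow> (\<exists>f y. inj_on f X \<and> f ` X = elts y)"


text \<open>
  Persistence modules: functors from the poset of the reals to vector spaces over \<open>K\<close>.
\<close>

record ('k, 'a) persmod =
  pspace :: "real \<Rightarrow> ('k, 'a) module"
  pmap :: "real \<Rightarrow> real \<Rightarrow> 'a \<Rightarrow> 'a"

definition persistence_module :: "'k ring \<Rightarrow> ('k, 'a) persmod \<Rightarrow> bool" where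
  "persistence_module K M \<longleftrightarrow>
     (\<forall>t. vectorspace K (pspace M t)) \<and>
     (\<forall>s t. s \<le> t \<longrightarrow> linear_map K (pspace M s) (pspace M t) (pmap M s t)) \<and>
     (\<forall>t. \<forall>x \<in> carrier (pspace M t). pmap M t t x = x) \<and>
     (\<forall>r s t. r \<le> s \<longrightarrow> s \<le> t \<longrightarrow>
        (\<forall>x \<in> carrier (pspace M r). pmap M s t (pmap M r s x) = pmap M r t x))"

definition persmod_iso :: "'k ring \<Rightarrow> ('k, 'a) persmod \<Rightarrow> ('k, 'b) persmod \<Rightarrow> bool" where
  "persmod_iso K M N \<longleftrightarrow>
     (\<exists>\<phi>. (\<forall>t. linear_map K (pspace M t) (pspace N t) (\<phi> t) \<and>
              bij_betw (\<phi> t) (carrier (pspace M t)) (carrier (pspace N t))) \<and>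
          (\<forall>s t. s \<le> t \<longrightarrow>
             (\<forall>x \<in> carrier (pspace M s). \<phi> t (pmap M s t x) = pmap N s t (\<phi> s x))))"

text \<open>
  In the records below, \<open>mult\<close> and \<open>one\<close> are unused fields inherited from rings.
\<close>

definition interval_module :: "'k ring \<Rightarrow> real set \<Rightarrow> ('k, 'k) persmod" where
  "interval_module K J =
     \<lparr>pspace = (\<lambda>t. \<lparr>carrier = (if t \<in> J then carrier K else {\<zero>\<^bsub>K\<^esub>}),
                     mult = undefined, one = undefined,
                     zero = \<zero>\<^bsub>K\<^esub>, add = add K, smult = mult K\<rparr>),
      pmap = (\<lambda>s t x. if s \<in> J \<and> t \<in> J then x else \<zero>\<^bsub>K\<^esub>)\<rparr>"

definition vs_direct_sum :: "'i set \<Rightarrow> ('i \<Rightarrow> ('k, 'a) module) \<Rightarrow> ('k, 'i \<Rightarrow> 'a) module" where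
  "vs_direct_sum A V =
     \<lparr>carrier = {f \<in> (\<Pi>\<^sub>E i\<in>A. carrier (V i)). finite {i \<in> A. f i \<noteq> \<zero>\<^bsub>V i\<^esub>}},
      mult = undefined, one = undefined,
      zero = (\<lambda>i\<in>A. \<zero>\<^bsub>V i\<^esub>),
      add = (\<lambda>f g. \<lambda>i\<in>A. f i \<oplus>\<^bsub>V i\<^esub> g i),
      smult = (\<lambda>c f. \<lambda>i\<in>A. c \<odot>\<^bsub>V i\<^esub> f i)\<rparr>"

definition persmod_direct_sum :: "'i set \<Rightarrow> ('i \<Rightarrow> ('k, 'a) persmod) \<Rightarrow> ('k, 'i \<Rightarrow> 'a) persmod" where
  "persmod_direct_sum A F =
     \<lparr>pspace = (\<lambda>t. vs_direct_sum A (\<lambda>i. pspace (F i) t)),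
      pmap = (\<lambda>s t f. \<lambda>i\<in>A. pmap (F i) s t (f i))\<rparr>"

text \<open>
  The index collection must be a set; as every set is in bijection with a set of elements of
  \<open>'v\<close>, it may be taken over \<open>'v\<close>.  Empty intervals contribute zero summands, so allowing them
  does not enlarge the class.
\<close>

definition interval_decomposable ::
    "('v \<Rightarrow> 'v set) \<Rightarrow> 'k ring \<Rightarrow> ('k, 'a) persmod \<Rightarrow> bool" where
  "interval_decomposable elts K M \<longleftrightarrow>
     (\<exists>(A :: 'v set) (J :: 'v \<Rightarrow> real set).
        small elts A \<and> (\<forall>\<alpha>\<in>A. is_interval (J \<alpha>)) \<and>
        persmod_iso K M (persmod_direct_sum A (\<lambda>\<alpha>. interval_module K (J \<alpha>))))"

definition q_tame :: "'k ring \<Rightarrow> ('k, 'a) persmod \<Rightarrow> bool" where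
  "q_tame K M \<longleftrightarrow>
     (\<forall>a b. a < b \<longrightarrow>
        vectorspace.fin_dim K ((pspace M b)\<lparr>carrier := pmap M a b ` carrier (pspace M a)\<rparr>))"


text \<open>
  The classes of persistence modules.  Their vector spaces are sets of elements of \<open>'v\<close>, that is,
  their carriers are small and not arbitrary subclasses of \<open>'v\<close>.
\<close>

definition pm_class :: "('v \<Rightarrow> 'v set) \<Rightarrow> 'k ring \<Rightarrow> ('k, 'v) persmod set" where
  "pm_class elts K =
     {M. persistence_module K M \<and> (\<forall>t. small elts (carrier (pspace M t)))}"

definition id_class :: "('v \<Rightarrow> 'v set) \<Rightarrow> 'k ring \<Rightarrow> ('k, 'v) persmod set" where
  "id_class elts K = {M \<in> pm_class elts K. interval_decomposable elts K M}"

definition qtame_class :: "('v \<Rightarrow> 'v set) \<Rightarrow> 'k ring \<Rightarrow> ('k, 'v) persmod set" where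
  "qtame_class elts K = {M \<in> pm_class elts K. q_tame K M}"

text \<open>
  Values of the record components outside the carriers are irrelevant to \<open>persmod_iso\<close>, so they do
  not affect the number of isomorphism classes.
\<close>

definition iso_classes :: "'k ring \<Rightarrow> ('k, 'a) persmod set \<Rightarrow> ('k, 'a) persmod set set" where
  "iso_classes K C = C // {(M, N). M \<in> C \<and> N \<in> C \<and> persmod_iso K M N}"

end

theory Submission
  imports Defs
begin

text \<open>
  The obstruction to being a set is already visible at a single point of the real line.  For a set
  \<open>p\<close> of the universe, the direct sum over \<open>elts p\<close> of copies of the interval module of the
  degenerate interval \<open>{0}\<close> is interval-decomposable by construction, and it is q-tame because all
  its maps between different points vanish.  Its space at \<open>0\<close> has a basis indexed by \<open>elts p\<close>, so
  it can be made as large as desired.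

  Suppose that the isomorphism classes of some class \<open>C\<close> of persistence modules containing all
  these modules formed a set.  Choose one representative of each isomorphism class; the union \<open>U\<close>
  of the spaces at \<open>0\<close> of the representatives is a set by replacement and union.  Each module of
  \<open>C\<close> is isomorphic to a representative, so its space at \<open>0\<close> injects into \<open>U\<close>; hence so does every
  set \<open>p\<close>, through the basis of the module it indexes.  For the power set of \<open>U\<close> this contradicts
  Cantor's theorem (\<open>not_small_iso_classes\<close>).  The argument compares cardinalities of carriers, and
  it serves all three classes alike because each contains the modules above
  (\<open>ex_skyscraper_module\<close>).

  What takes space is that a direct sum consists of functions, whereas the members of the classes
  must have their vectors in the universe.  The finitely supported functions from a set to \<open>K\<close> are
  at most as numerous as a set (\<open>small_PiE\<close>), so they can be named by elements of the universe, and
  the structure is carried along the naming (\<open>relabel_properties\<close>).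
\<close>

section \<open>Small collections\<close>

context zfc_universe
begin

lemma small_elts: "small elts (elts x)"
  unfolding small_def by (metis inj_on_id image_ident id_apply image_id)

text \<open>
  Smallness asks for a bijection with a set; by separation an injection into a small collection is
  enough, which is how products, power collections and function collections are treated below.
\<close>
lemma small_inj:
  assumes "inj_on f X" "f ` X \<subseteq> Y" "small elts Y"
  shows "small elts X"
proof -
  obtain h y where h: "inj_on h Y" "h ` Y = elts y"
    using assms(3) unfolding small_def by blast
  have "(h \<circ> f) ` X \<subseteq> elts y" using h(2) assms(2) by auto
  then obtain z where "elts z = (h \<circ> f) ` X" using separation by blast
  moreover have "inj_on (h \<circ> f) X"
    using assms(1,2) h(1) by (meson comp_inj_on inj_on_subset)
  ultimately show ?thesis unfolding small_def by metis
qed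

text \<open>
  For classes over the universe itself the renaming in the definition of smallness can be undone,
  by replacement along the inverse bijection.
\<close>
lemma small_imp_elts:
  fixes X :: "'v set"
  assumes "small elts X"
  obtains x where "elts x = X"
proof -
  obtain f y where f: "inj_on f X" "f ` X = elts y"
    using assms unfolding small_def by blast
  obtain x where "elts x = inv_into X f ` elts y" using replacement by blast
  moreover have "inv_into X f ` elts y = X"
    unfolding f(2)[symmetric] using f(1) by (rule inv_into_image_cancel) simp
  ultimately show thesis using that by simp
qed

lemma small_UN:
  fixes F :: "'i \<Rightarrow> 'v set"
  assumes "small elts I" "\<And>i. i \<in> I \<Longrightarrow> small elts (F i)"
  shows "small elts (\<Union>i\<in>I. F i)"
proof -
  obtain h y where h: "inj_on h I" "h ` I = elts y"
    using assms(1) unfolding small_def by blast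
  have "\<forall>i\<in>I. \<exists>c. elts c = F i" using assms(2) small_imp_elts by metis
  then obtain c where c: "\<And>i. i \<in> I \<Longrightarrow> elts (c i) = F i" by metis
  obtain w where w: "elts w = (\<lambda>a. c (inv_into I h a)) ` elts y" using replacement by blast
  have "elts w = c ` I"
    unfolding w h(2)[symmetric] image_image using h(1) by simp
  moreover obtain z where "elts z = (\<Union>a\<in>elts w. elts a)" using union by blast
  ultimately have "elts z = (\<Union>i\<in>I. F i)" using c by simp
  then show ?thesis using small_elts by metis
qed

text \<open>
  Any function on the natural numbers has a set as range, in particular one with two values.
\<close>
lemma ex_unordered_pair: "\<exists>u. elts u = {a, b}"
proof -
  obtain u where "elts u = range (\<lambda>n::nat. if n = 0 then a else b)" using infinity by blast
  moreover have "range (\<lambda>n::nat. if n = 0 then a else b) = {a, b}"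
    by (auto simp: image_iff split: if_splits)
  ultimately show ?thesis by auto
qed

text \<open>
  Kuratowski's pair \<open>{{a}, {a, b}}\<close>.
\<close>
lemma ex_ordered_pairing: "\<exists>P :: 'v \<Rightarrow> 'v \<Rightarrow> 'v. \<forall>a b c d. P a b = P c d \<longrightarrow> a = c \<and> b = d"
proof -
  obtain u where u: "\<And>a b. elts (u a b) = {a, b}" using ex_unordered_pair by metis
  have "u a b = u c d \<Longrightarrow> {a, b} = {c, d}" for a b c d using u by metis
  then have "u (u a a) (u a b) = u (u c c) (u c d) \<Longrightarrow> a = c \<and> b = d" for a b c d
    by (metis doubleton_eq_iff)
  then show ?thesis by (intro exI[of _ "\<lambda>a b. u (u a a) (u a b)"]) blast
qed

lemma small_Times:
  assumes "small elts X" "small elts Y"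
  shows "small elts (X \<times> Y)"
proof -
  obtain h x where h: "inj_on h X" "h ` X = elts x" using assms(1) unfolding small_def by blast
  obtain k y where k: "inj_on k Y" "k ` Y = elts y" using assms(2) unfolding small_def by blast
  obtain P :: "'v \<Rightarrow> 'v \<Rightarrow> 'v" where P: "\<And>a b c d. P a b = P c d \<Longrightarrow> a = c \<and> b = d"
    using ex_ordered_pairing by metis
  have "small elts (P a ` elts y)" for a using replacement small_elts by metis
  then have "small elts (\<Union>a\<in>elts x. P a ` elts y)" by (intro small_UN small_elts)
  moreover have "inj_on (\<lambda>(a, b). P (h a) (k b)) (X \<times> Y)"
    using h(1) k(1) by (auto simp: inj_on_def dest!: P)
  moreover have "(\<lambda>(a, b). P (h a) (k b)) ` (X \<times> Y) \<subseteq> (\<Union>a\<in>elts x. P a ` elts y)"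
    unfolding h(2)[symmetric] k(2)[symmetric] by auto
  ultimately show ?thesis by (rule small_inj[rotated 2])
qed

lemma small_Pow:
  assumes "small elts X"
  shows "small elts (Pow X)"
proof -
  obtain h x where h: "inj_on h X" "h ` X = elts x" using assms unfolding small_def by blast
  obtain p where p: "elts p = {z. elts z \<subseteq> elts x}" using powerset by blast
  have "\<forall>S\<in>Pow X. \<exists>z. elts z = h ` S" using h(2) separation by (metis PowD image_mono)
  then obtain c where c: "\<And>S. S \<subseteq> X \<Longrightarrow> elts (c S) = h ` S" by (metis PowI)
  have "inj_on c (Pow X)"
    using c h(1) by (intro inj_onI) (metis PowD inj_on_image_eq_iff)
  moreover have "c S \<in> elts p" if "S \<subseteq> X" for S
    using that by (simp add: p c h(2)[symmetric] image_mono)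
  then have "c ` Pow X \<subseteq> elts p" by auto
  ultimately show ?thesis using small_elts by (rule small_inj)
qed

text \<open>
  A function is determined by its graph, a subset of \<open>A \<times> B\<close>.
\<close>
lemma small_PiE:
  assumes "small elts A" "small elts B"
  shows "small elts (A \<rightarrow>\<^sub>E B)"
proof -
  let ?graph = "\<lambda>f. (\<lambda>i. (i, f i)) ` A"
  have "inj_on ?graph (A \<rightarrow>\<^sub>E B)"
    by (intro inj_onI PiE_ext) auto
  moreover have "?graph ` (A \<rightarrow>\<^sub>E B) \<subseteq> Pow (A \<times> B)" by auto
  ultimately show ?thesis using small_Pow[OF small_Times[OF assms]] by (rule small_inj)
qed

text \<open>
  Cantor's theorem inside the universe, with \<open>p\<close> the power set of a copy \<open>u\<close> of \<open>U\<close>.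
\<close>
lemma ex_not_injecting_into_small:
  assumes "small elts U"
  obtains p where "\<And>f. inj_on f (elts p) \<Longrightarrow> \<not> f ` elts p \<subseteq> U"
proof -
  obtain h u where h: "inj_on h U" "h ` U = elts u" using assms unfolding small_def by blast
  obtain p where p: "elts p = {z. elts z \<subseteq> elts u}" using powerset by blast
  have False if f: "inj_on f (elts p)" "f ` elts p \<subseteq> U" for f
  proof -
    define g where "g = h \<circ> f"
    have g: "inj_on g (elts p)" "g ` elts p \<subseteq> elts u"
      unfolding g_def using f h by (auto intro: comp_inj_on inj_on_subset)
    (* The diagonal set: a member z of p whose name g z escapes z contributes that name. *)
    obtain d where d: "elts d = {g z |z. z \<in> elts p \<and> g z \<notin> elts z}"
      using separation[of "{g z |z. z \<in> elts p \<and> g z \<notin> elts z}" u] g(2) by auto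
    have "d \<in> elts p" using p d g(2) by auto
    then have "g d \<in> elts d \<longleftrightarrow> g d \<notin> elts d"
      using d g(1) by (auto dest: inj_onD)
    then show False by blast
  qed
  then show thesis using that by blast
qed

end

section \<open>Vector spaces and persistence modules\<close>

lemma persmod_iso_refl:
  assumes "persistence_module K M"
  shows "persmod_iso K M M"
proof -
  have "linear_map K (pspace M t) (pspace M t) (\<lambda>x. x)" for t
  proof -
    interpret V: vectorspace K "pspace M t" using assms unfolding persistence_module_def by blast
    show ?thesis by unfold_locales (auto simp: module_hom_def)
  qed
  then show ?thesis unfolding persmod_iso_def
    by (intro exI[of _ "\<lambda>t x. x"]) (auto simp: bij_betw_def)
qed

lemma linear_mapI:
  assumes "vectorspace K V" "vectorspace K W"
    and "\<And>x. x \<in> carrier V \<Longrightarrow> f x \<in> carrier W"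
    and "\<And>x y. x \<in> carrier V \<Longrightarrow> y \<in> carrier V \<Longrightarrow> f (x \<oplus>\<^bsub>V\<^esub> y) = f x \<oplus>\<^bsub>W\<^esub> f y"
    and "\<And>c x. c \<in> carrier K \<Longrightarrow> x \<in> carrier V \<Longrightarrow> f (c \<odot>\<^bsub>V\<^esub> x) = c \<odot>\<^bsub>W\<^esub> f x"
  shows "linear_map K V W f"
proof -
  interpret V: vectorspace K V by fact
  interpret W: vectorspace K W by fact
  show ?thesis by unfold_locales (auto simp: module_hom_def assms)
qed

lemma linear_mapD:
  assumes "linear_map K V W f"
  shows "x \<in> carrier V \<Longrightarrow> f x \<in> carrier W"
    and "x \<in> carrier V \<Longrightarrow> y \<in> carrier V \<Longrightarrow> f (x \<oplus>\<^bsub>V\<^esub> y) = f x \<oplus>\<^bsub>W\<^esub> f y"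
    and "c \<in> carrier K \<Longrightarrow> x \<in> carrier V \<Longrightarrow> f (c \<odot>\<^bsub>V\<^esub> x) = c \<odot>\<^bsub>W\<^esub> f x"
    and "f \<zero>\<^bsub>V\<^esub> = \<zero>\<^bsub>W\<^esub>"
proof -
  interpret linear_map K V W f by fact
  show "x \<in> carrier V \<Longrightarrow> f x \<in> carrier W"
    "x \<in> carrier V \<Longrightarrow> y \<in> carrier V \<Longrightarrow> f (x \<oplus>\<^bsub>V\<^esub> y) = f x \<oplus>\<^bsub>W\<^esub> f y"
    "c \<in> carrier K \<Longrightarrow> x \<in> carrier V \<Longrightarrow> f (c \<odot>\<^bsub>V\<^esub> x) = c \<odot>\<^bsub>W\<^esub> f x"
    "f \<zero>\<^bsub>V\<^esub> = \<zero>\<^bsub>W\<^esub>"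
    by (auto simp: f_im f_add f_smult)
qed

text \<open>
  The last hypothesis stands in for the existence of negatives: with it, \<open>- 1\<close> times \<open>x\<close> is a
  negative of \<open>x\<close>.  For the pointwise structures below it is much easier to check.
\<close>
lemma vectorspaceI:
  fixes K (structure) and V (structure)
  assumes "field K"
    and "\<And>x y. x \<in> carrier V \<Longrightarrow> y \<in> carrier V \<Longrightarrow> x \<oplus>\<^bsub>V\<^esub> y \<in> carrier V"
    and "\<zero>\<^bsub>V\<^esub> \<in> carrier V"
    and "\<And>x y z. x \<in> carrier V \<Longrightarrow> y \<in> carrier V \<Longrightarrow> z \<in> carrier V \<Longrightarrow>
           x \<oplus>\<^bsub>V\<^esub> y \<oplus>\<^bsub>V\<^esub> z = x \<oplus>\<^bsub>V\<^esub> (y \<oplus>\<^bsub>V\<^esub> z)"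
    and "\<And>x y. x \<in> carrier V \<Longrightarrow> y \<in> carrier V \<Longrightarrow> x \<oplus>\<^bsub>V\<^esub> y = y \<oplus>\<^bsub>V\<^esub> x"
    and "\<And>x. x \<in> carrier V \<Longrightarrow> \<zero>\<^bsub>V\<^esub> \<oplus>\<^bsub>V\<^esub> x = x"
    and "\<And>c x. c \<in> carrier K \<Longrightarrow> x \<in> carrier V \<Longrightarrow> c \<odot>\<^bsub>V\<^esub> x \<in> carrier V"
    and "\<And>c d x. c \<in> carrier K \<Longrightarrow> d \<in> carrier K \<Longrightarrow> x \<in> carrier V \<Longrightarrow>
           (c \<oplus>\<^bsub>K\<^esub> d) \<odot>\<^bsub>V\<^esub> x = c \<odot>\<^bsub>V\<^esub> x \<oplus>\<^bsub>V\<^esub> d \<odot>\<^bsub>V\<^esub> x"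
    and "\<And>c x y. c \<in> carrier K \<Longrightarrow> x \<in> carrier V \<Longrightarrow> y \<in> carrier V \<Longrightarrow>
           c \<odot>\<^bsub>V\<^esub> (x \<oplus>\<^bsub>V\<^esub> y) = c \<odot>\<^bsub>V\<^esub> x \<oplus>\<^bsub>V\<^esub> c \<odot>\<^bsub>V\<^esub> y"
    and "\<And>c d x. c \<in> carrier K \<Longrightarrow> d \<in> carrier K \<Longrightarrow> x \<in> carrier V \<Longrightarrow>
           (c \<otimes>\<^bsub>K\<^esub> d) \<odot>\<^bsub>V\<^esub> x = c \<odot>\<^bsub>V\<^esub> (d \<odot>\<^bsub>V\<^esub> x)"
    and "\<And>x. x \<in> carrier V \<Longrightarrow> \<one>\<^bsub>K\<^esub> \<odot>\<^bsub>V\<^esub> x = x"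
    and "\<And>x. x \<in> carrier V \<Longrightarrow> \<zero>\<^bsub>K\<^esub> \<odot>\<^bsub>V\<^esub> x = \<zero>\<^bsub>V\<^esub>"
  shows "vectorspace K V"
proof -
  interpret K: field K by fact
  have "abelian_group V"
  proof (rule abelian_groupI)
    fix x assume x: "x \<in> carrier V"
    have "(\<ominus>\<^bsub>K\<^esub> \<one>\<^bsub>K\<^esub>) \<odot>\<^bsub>V\<^esub> x \<oplus>\<^bsub>V\<^esub> x = (\<ominus>\<^bsub>K\<^esub> \<one>\<^bsub>K\<^esub> \<oplus>\<^bsub>K\<^esub> \<one>\<^bsub>K\<^esub>) \<odot>\<^bsub>V\<^esub> x"
      using x assms(8,11) by simp
    also have "\<dots> = \<zero>\<^bsub>V\<^esub>" using x assms(12) by (simp add: K.l_neg)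
    finally show "\<exists>y\<in>carrier V. y \<oplus>\<^bsub>V\<^esub> x = \<zero>\<^bsub>V\<^esub>" using x assms(7) by blast
  qed (use assms in blast)+
  then have "module K V"
    using assms by (intro moduleI) (auto intro: K.is_cring)
  then show ?thesis using assms(1) by (rule vectorspace.intro)
qed

text \<open>
  Convexity of \<open>J\<close> is what makes the maps compose: if \<open>r \<le> s \<le> t\<close> with \<open>r\<close> and \<open>t\<close> in \<open>J\<close>,
  the identity from \<open>r\<close> to \<open>t\<close> must not factor through the zero space at \<open>s\<close>.
\<close>
lemma persistence_module_interval_module:
  assumes "field K" "is_interval J"
  shows "persistence_module K (interval_module K J)"
proof -
  interpret field K by fact
  let ?M = "interval_module K J"
  have vs: "vectorspace K (pspace ?M t)" for t
    by (rule vectorspaceI)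
      (auto simp: interval_module_def assms(1) a_ac m_assoc l_distr r_distr
        split: if_splits)
  have "linear_map K (pspace ?M s) (pspace ?M t) (pmap ?M s t)" if "s \<le> t" for s t
    by (rule linear_mapI[OF vs vs]) (auto simp: interval_module_def split: if_splits)
  moreover have "pmap ?M t t x = x" if "x \<in> carrier (pspace ?M t)" for t x
    using that by (auto simp: interval_module_def split: if_splits)
  moreover have "pmap ?M s t (pmap ?M r s x) = pmap ?M r t x" if "r \<le> s" "s \<le> t" for r s t x
  proof -
    have "s \<in> J" if "r \<in> J" "t \<in> J"
      using assms(2) that \<open>r \<le> s\<close> \<open>s \<le> t\<close> unfolding is_interval_1 by blast
    then show ?thesis by (simp add: interval_module_def)
  qed
  ultimately show ?thesis using vs unfolding persistence_module_def by blast
qed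

lemma vectorspace_vs_direct_sum:
  assumes "field K" "\<And>i. i \<in> A \<Longrightarrow> vectorspace K (V i)"
  shows "vectorspace K (vs_direct_sum A V)"
proof -
  have m: "module K (V i)" if "i \<in> A" for i
    using assms(2)[OF that] by (rule vectorspace.axioms)
  have ab: "abelian_group (V i)" if "i \<in> A" for i
    using m[OF that] by (rule module.axioms)
  have add: "x \<oplus>\<^bsub>V i\<^esub> y \<in> carrier (V i)" if "i \<in> A" "x \<in> carrier (V i)" "y \<in> carrier (V i)" for i x y
    using ab that by (meson abelian_groupE(1))
  have zero: "\<zero>\<^bsub>V i\<^esub> \<in> carrier (V i)" if "i \<in> A" for i
    using ab that by (meson abelian_groupE(2))
  have zz: "\<zero>\<^bsub>V i\<^esub> \<oplus>\<^bsub>V i\<^esub> \<zero>\<^bsub>V i\<^esub> = \<zero>\<^bsub>V i\<^esub>" if "i \<in> A" for i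
    using ab zero that by (meson abelian_groupE(5))
  have finadd: "finite {i \<in> A. f i \<oplus>\<^bsub>V i\<^esub> g i \<noteq> \<zero>\<^bsub>V i\<^esub>}"
    if "finite {i \<in> A. f i \<noteq> \<zero>\<^bsub>V i\<^esub>}" "finite {i \<in> A. g i \<noteq> \<zero>\<^bsub>V i\<^esub>}" for f g
    by (rule finite_subset[OF _ finite_UnI[OF that]]) (auto simp: zz)
  have finsmult: "finite {i \<in> A. c \<odot>\<^bsub>V i\<^esub> f i \<noteq> \<zero>\<^bsub>V i\<^esub>}"
    if "finite {i \<in> A. f i \<noteq> \<zero>\<^bsub>V i\<^esub>}" "c \<in> carrier K" for f c
    by (rule finite_subset[OF _ that(1)]) (auto simp: module.smult_r_null[OF m that(2)])
  have coord: "f i \<in> carrier (V i)" if "f \<in> carrier (vs_direct_sum A V)" "i \<in> A" for f i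
    using that by (auto simp: vs_direct_sum_def)
  have restr: "restrict f A = f" if "f \<in> carrier (vs_direct_sum A V)" for f
    using that by (auto simp: vs_direct_sum_def PiE_def extensional_restrict)
  let ?D = "vs_direct_sum A V"
  have D: "add ?D f g = (\<lambda>i\<in>A. f i \<oplus>\<^bsub>V i\<^esub> g i)" "smult ?D c f = (\<lambda>i\<in>A. c \<odot>\<^bsub>V i\<^esub> f i)"
    "zero ?D = (\<lambda>i\<in>A. \<zero>\<^bsub>V i\<^esub>)" for f g c
    by (simp_all add: vs_direct_sum_def)
  note [simp] = coord D
  show ?thesis
  proof (rule vectorspaceI[OF assms(1)])
    fix f g assume "f \<in> carrier ?D" "g \<in> carrier ?D"
    then show "add ?D f g \<in> carrier ?D" "add ?D f g = add ?D g f"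
      by (auto simp: vs_direct_sum_def finadd add abelian_groupE(4)[OF ab]
          cong: restrict_cong conj_cong)
  next
    show "zero ?D \<in> carrier ?D" by (auto simp: vs_direct_sum_def zero)
  next
    fix f g h assume "f \<in> carrier ?D" "g \<in> carrier ?D" "h \<in> carrier ?D"
    then show "add ?D (add ?D f g) h = add ?D f (add ?D g h)"
      by (auto simp: abelian_groupE(3)[OF ab] cong: restrict_cong)
  next
    fix f assume f: "f \<in> carrier ?D"
    have "add ?D (zero ?D) f = restrict f A"
      using f by (auto simp: abelian_groupE(5)[OF ab] cong: restrict_cong)
    then show "add ?D (zero ?D) f = f" using restr[OF f] by simp
    have "smult ?D \<one>\<^bsub>K\<^esub> f = restrict f A"
      using f by (auto simp: module.smult_one[OF m] cong: restrict_cong)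
    then show "smult ?D \<one>\<^bsub>K\<^esub> f = f" using restr[OF f] by simp
    show "smult ?D \<zero>\<^bsub>K\<^esub> f = zero ?D"
      using f by (auto simp: module.smult_l_null[OF m] cong: restrict_cong)
  next
    fix c f assume "c \<in> carrier K" "f \<in> carrier ?D"
    then show "smult ?D c f \<in> carrier ?D"
      by (auto simp: vs_direct_sum_def finsmult module.smult_closed[OF m] cong: conj_cong)
  next
    fix c d f assume "c \<in> carrier K" "d \<in> carrier K" "f \<in> carrier ?D"
    then show "smult ?D (add K c d) f = add ?D (smult ?D c f) (smult ?D d f)"
      "smult ?D (mult K c d) f = smult ?D c (smult ?D d f)"
      by (auto simp: module.smult_l_distr[OF m] module.smult_assoc1[OF m] cong: restrict_cong)
  next
    fix c f g assume "c \<in> carrier K" "f \<in> carrier ?D" "g \<in> carrier ?D"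
    then show "smult ?D c (add ?D f g) = add ?D (smult ?D c f) (smult ?D c g)"
      by (auto simp: module.smult_r_distr[OF m] cong: restrict_cong)
  qed
qed

lemma persistence_module_direct_sum:
  assumes "field K" "\<And>i. i \<in> A \<Longrightarrow> persistence_module K (F i)"
  shows "persistence_module K (persmod_direct_sum A F)"
proof -
  let ?D = "persmod_direct_sum A F"
  have pspace: "pspace ?D t = vs_direct_sum A (\<lambda>i. pspace (F i) t)" for t
    by (simp add: persmod_direct_sum_def)
  have pmap: "pmap ?D s t f = (\<lambda>i\<in>A. pmap (F i) s t (f i))" for s t f
    by (simp add: persmod_direct_sum_def)
  have vs: "vectorspace K (pspace ?D t)" for t
    unfolding pspace using assms unfolding persistence_module_def
    by (intro vectorspace_vs_direct_sum) auto
  have lin: "linear_map K (pspace (F i) s) (pspace (F i) t) (pmap (F i) s t)"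
    if "i \<in> A" "s \<le> t" for i s t
    using assms(2)[OF that(1)] that(2) unfolding persistence_module_def by blast
  have coord: "f i \<in> carrier (pspace (F i) t)" if "f \<in> carrier (pspace ?D t)" "i \<in> A" for f i t
    using that by (auto simp: pspace vs_direct_sum_def)
  have "linear_map K (pspace ?D s) (pspace ?D t) (pmap ?D s t)" if "s \<le> t" for s t
  proof (rule linear_mapI[OF vs vs])
    fix f assume f: "f \<in> carrier (pspace ?D s)"
    have "finite {i \<in> A. f i \<noteq> \<zero>\<^bsub>pspace (F i) s\<^esub>}"
      using f by (auto simp: pspace vs_direct_sum_def)
    (* A linear map sends zero to zero, so it cannot enlarge the support. *)
    moreover have "{i \<in> A. pmap (F i) s t (f i) \<noteq> \<zero>\<^bsub>pspace (F i) t\<^esub>}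
        \<subseteq> {i \<in> A. f i \<noteq> \<zero>\<^bsub>pspace (F i) s\<^esub>}"
      using linear_mapD(4)[OF lin[OF _ \<open>s \<le> t\<close>]] by auto
    ultimately have "finite {i \<in> A. pmap (F i) s t (f i) \<noteq> \<zero>\<^bsub>pspace (F i) t\<^esub>}"
      by (rule rev_finite_subset)
    then show "pmap ?D s t f \<in> carrier (pspace ?D t)"
      using linear_mapD(1)[OF lin[OF _ \<open>s \<le> t\<close>]] coord[OF f]
      by (auto simp: pmap pspace vs_direct_sum_def cong: conj_cong)
  next
    fix f g assume f: "f \<in> carrier (pspace ?D s)" and g: "g \<in> carrier (pspace ?D s)"
    show "pmap ?D s t (f \<oplus>\<^bsub>pspace ?D s\<^esub> g) = pmap ?D s t f \<oplus>\<^bsub>pspace ?D t\<^esub> pmap ?D s t g"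
      using linear_mapD(2)[OF lin[OF _ \<open>s \<le> t\<close>]] coord[OF f] coord[OF g]
      by (auto simp: pmap pspace vs_direct_sum_def cong: restrict_cong)
  next
    fix c f assume c: "c \<in> carrier K" and f: "f \<in> carrier (pspace ?D s)"
    show "pmap ?D s t (c \<odot>\<^bsub>pspace ?D s\<^esub> f) = c \<odot>\<^bsub>pspace ?D t\<^esub> pmap ?D s t f"
      using linear_mapD(3)[OF lin[OF _ \<open>s \<le> t\<close>] c] coord[OF f]
      by (auto simp: pmap pspace vs_direct_sum_def cong: restrict_cong)
  qed
  moreover have "pmap ?D t t f = f" if f: "f \<in> carrier (pspace ?D t)" for t f
  proof -
    have "pmap ?D t t f = restrict f A"
      unfolding pmap using assms(2) coord[OF f] unfolding persistence_module_def
      by (intro restrict_ext) blast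
    also have "\<dots> = f" using f by (auto simp: pspace vs_direct_sum_def PiE_def extensional_restrict)
    finally show ?thesis .
  qed
  moreover have "pmap ?D s t (pmap ?D r s f) = pmap ?D r t f"
    if f: "f \<in> carrier (pspace ?D r)" and "r \<le> s" "s \<le> t" for r s t f
  proof -
    have "pmap (F i) s t (pmap (F i) r s (f i)) = pmap (F i) r t (f i)" if "i \<in> A" for i
      using assms(2)[OF that] coord[OF f that] \<open>r \<le> s\<close> \<open>s \<le> t\<close>
      unfolding persistence_module_def by blast
    then show ?thesis unfolding pmap by (intro restrict_ext) simp
  qed
  ultimately show ?thesis using vs unfolding persistence_module_def by blast
qed

section \<open>Renaming the vectors of a persistence module\<close>

text \<open>
  One naming \<open>e\<close>, injective on \<open>X\<close>, serves the spaces at all points; it is meant to be used when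
  \<open>X\<close> contains all of them.
\<close>
definition relabel :: "('a \<Rightarrow> 'b) \<Rightarrow> 'a set \<Rightarrow> ('k, 'a) persmod \<Rightarrow> ('k, 'b) persmod" where
  "relabel e X M = (let d = inv_into X e in
     \<lparr>pspace = (\<lambda>t. \<lparr>carrier = e ` carrier (pspace M t),
                     mult = undefined, one = undefined,
                     zero = e \<zero>\<^bsub>pspace M t\<^esub>,
                     add = (\<lambda>x y. e (d x \<oplus>\<^bsub>pspace M t\<^esub> d y)),
                     smult = (\<lambda>c x. e (c \<odot>\<^bsub>pspace M t\<^esub> d x))\<rparr>),
      pmap = (\<lambda>s t x. e (pmap M s t (d x)))\<rparr>)"

lemma relabel_properties:
  assumes "persistence_module K M" "inj_on e X" "\<And>t. carrier (pspace M t) \<subseteq> X"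
  shows persistence_module_relabel: "persistence_module K (relabel e X M)"
    and persmod_iso_relabel: "persmod_iso K (relabel e X M) M"
proof -
  define d where "d = inv_into X e"
  let ?R = "relabel e X M"
  have d [simp]: "d (e x) = x" if "x \<in> carrier (pspace M t)" for x t
    unfolding d_def using assms(2,3) that by (meson inv_into_f_f subsetD)
  have R [simp]: "carrier (pspace ?R t) = e ` carrier (pspace M t)"
    "\<zero>\<^bsub>pspace ?R t\<^esub> = e \<zero>\<^bsub>pspace M t\<^esub>"
    "x \<oplus>\<^bsub>pspace ?R t\<^esub> y = e (d x \<oplus>\<^bsub>pspace M t\<^esub> d y)"
    "c \<odot>\<^bsub>pspace ?R t\<^esub> x = e (c \<odot>\<^bsub>pspace M t\<^esub> d x)"
    "pmap ?R s t x = e (pmap M s t (d x))" for s t x y c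
    by (simp_all add: relabel_def Let_def d_def)
  have vsM: "vectorspace K (pspace M t)" for t
    using assms(1) unfolding persistence_module_def by blast
  have lin: "linear_map K (pspace M s) (pspace M t) (pmap M s t)" if "s \<le> t" for s t
    using assms(1) that unfolding persistence_module_def by blast
  have vs: "vectorspace K (pspace ?R t)" for t
  proof -
    interpret V: vectorspace K "pspace M t" by (rule vsM)
    note mem = V.a_closed[THEN d] V.smult_closed[THEN d] V.M.zero_closed[THEN d]
    show ?thesis
      by (rule vectorspaceI[OF V.field_axioms])
        (auto simp: mem V.M.a_ac V.smult_l_distr V.smult_r_distr V.smult_assoc1)
  qed
  have "linear_map K (pspace ?R s) (pspace ?R t) (pmap ?R s t)" if "s \<le> t" for s t
  proof -
    interpret V: vectorspace K "pspace M s" by (rule vsM)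
    interpret W: vectorspace K "pspace M t" by (rule vsM)
    note L = linear_mapD[OF lin[OF that]]
    note mem = V.a_closed[THEN d] V.smult_closed[THEN d] L(1)[THEN d]
    show ?thesis by (rule linear_mapI[OF vs vs]) (auto simp: mem L)
  qed
  moreover have "pmap ?R t t x = x" if "x \<in> carrier (pspace ?R t)" for t x
    using assms(1) that unfolding persistence_module_def by auto
  moreover have "pmap ?R s t (pmap ?R r s x) = pmap ?R r t x"
    if "x \<in> carrier (pspace ?R r)" "r \<le> s" "s \<le> t" for r s t x
    using assms(1) that linear_mapD(1)[OF lin[OF \<open>r \<le> s\<close>], THEN d]
    unfolding persistence_module_def by auto
  ultimately show "persistence_module K ?R" using vs unfolding persistence_module_def by blast
  (* The isomorphism is the decoding map d, the inverse of the naming. *)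
  have "linear_map K (pspace ?R t) (pspace M t) d" for t
  proof -
    interpret V: vectorspace K "pspace M t" by (rule vsM)
    note mem = V.a_closed[THEN d] V.smult_closed[THEN d]
    show ?thesis by (rule linear_mapI[OF vs vsM]) (auto simp: mem)
  qed
  moreover have "bij_betw d (carrier (pspace ?R t)) (carrier (pspace M t))" for t
    by (rule bij_betw_byWitness[of _ e]) auto
  moreover have "d (pmap ?R s t x) = pmap M s t (d x)"
    if "s \<le> t" "x \<in> carrier (pspace ?R s)" for s t x
    using that linear_mapD(1)[OF lin[OF \<open>s \<le> t\<close>], THEN d] by auto
  ultimately show "persmod_iso K ?R M" unfolding persmod_iso_def by (intro exI[of _ "\<lambda>_. d"]) blast
qed

section \<open>Large modules concentrated at a point\<close>

text \<open>
  The image of a zero map is spanned by the empty set.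
\<close>
lemma q_tame_if_zero_maps:
  assumes "persistence_module K M"
    and "\<And>a b x. a < b \<Longrightarrow> x \<in> carrier (pspace M a) \<Longrightarrow> pmap M a b x = \<zero>\<^bsub>pspace M b\<^esub>"
  shows "q_tame K M"
  unfolding q_tame_def
proof (intro allI impI)
  fix a b :: real assume "a < b"
  have vs: "vectorspace K (pspace M t)" for t
    using assms(1) unfolding persistence_module_def by blast
  interpret V: vectorspace K "pspace M a" by (rule vs)
  interpret W: vectorspace K "pspace M b" by (rule vs)
  let ?Z = "(pspace M b)\<lparr>carrier := {\<zero>\<^bsub>pspace M b\<^esub>}\<rparr>"
  have im: "pmap M a b ` carrier (pspace M a) = {\<zero>\<^bsub>pspace M b\<^esub>}"
    using assms(2)[OF \<open>a < b\<close>] V.M.zero_closed by force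
  have Z: "vectorspace K ?Z"
    by (rule vectorspaceI[OF V.field_axioms]) auto
  have "\<zero>\<^bsub>?Z\<^esub> = \<zero>\<^bsub>pspace M b\<^esub>" by simp
  then have "vectorspace.fin_dim K ?Z"
    unfolding vectorspace.fin_dim_def[OF Z]
    by (intro exI[of _ "{}"]) (simp add: vectorspace.span_empty[OF Z])
  then show "vectorspace.fin_dim K ((pspace M b)\<lparr>carrier := pmap M a b ` carrier (pspace M a)\<rparr>)"
    by (simp add: im)
qed

text \<open>
  The module is concentrated at \<open>0\<close>, where it is the vector space with basis \<open>elts p\<close>, its vectors
  renamed to elements of the universe; the maps between different points are zero.
\<close>
lemma (in zfc_universe) ex_skyscraper_module:
  fixes K :: "'k ring"
  assumes "field K" "small elts (carrier K)"
  shows "\<exists>M. M \<in> id_class elts K \<inter> qtame_class elts K \<and>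
           (\<exists>b. inj_on b (elts p) \<and> b ` elts p \<subseteq> carrier (pspace M 0))"
proof -
  interpret field K by fact
  let ?S = "persmod_direct_sum (elts p) (\<lambda>_. interval_module K {0})"
  let ?X = "elts p \<rightarrow>\<^sub>E carrier K"
  have S: "persistence_module K ?S"
    by (intro persistence_module_direct_sum persistence_module_interval_module assms(1))
      (simp add: is_interval_1)
  have sub: "carrier (pspace ?S t) \<subseteq> ?X" for t
  proof -
    have "carrier (pspace ?S t) \<subseteq> (\<Pi>\<^sub>E i\<in>elts p. carrier (pspace (interval_module K {0}) t))"
      by (simp add: persmod_direct_sum_def vs_direct_sum_def)
    also have "\<dots> \<subseteq> ?X" by (rule PiE_mono) (simp add: interval_module_def)
    finally show ?thesis .
  qed
  have "small elts ?X" using assms(2) small_elts by (intro small_PiE)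
  then obtain e :: "('v \<Rightarrow> 'k) \<Rightarrow> 'v" and y where e: "inj_on e ?X" "e ` ?X = elts y"
    unfolding small_def by blast
  define M where "M = relabel e ?X ?S"
  have M: "persistence_module K M" "persmod_iso K M ?S"
    unfolding M_def using relabel_properties[OF S e(1) sub] by auto
  have carrier: "carrier (pspace M t) = e ` carrier (pspace ?S t)" for t
    by (simp add: M_def relabel_def Let_def)
  have "small elts (carrier (pspace M t))" for t
  proof -
    have "carrier (pspace M t) \<subseteq> elts y" unfolding carrier e(2)[symmetric] using sub by blast
    then show ?thesis by (intro small_inj[OF inj_on_id _ small_elts]) simp
  qed
  then have pm: "M \<in> pm_class elts K" using M(1) by (simp add: pm_class_def)
  have id: "interval_decomposable elts K M"
    unfolding interval_decomposable_def using M(2) small_elts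
    by (intro exI[of _ "elts p"] exI[of _ "\<lambda>_. {0}"]) (simp add: is_interval_1)
  have qt: "q_tame K M"
  proof (rule q_tame_if_zero_maps[OF M(1)])
    fix a b :: real and x assume "a < b"
    then have "pmap M a b x = e (\<lambda>i\<in>elts p. \<zero>\<^bsub>K\<^esub>)"
      by (auto simp: M_def relabel_def Let_def persmod_direct_sum_def interval_module_def
          intro!: arg_cong[of _ _ e] restrict_ext)
    also have "\<dots> = \<zero>\<^bsub>pspace M b\<^esub>"
      by (simp add: M_def relabel_def Let_def persmod_direct_sum_def interval_module_def vs_direct_sum_def)
    finally show "pmap M a b x = \<zero>\<^bsub>pspace M b\<^esub>" .
  qed
  (* The standard basis; distinct indices give distinct vectors as 1 and 0 differ in a field. *)
  define b where "b \<alpha> = (\<lambda>i\<in>elts p. if i = \<alpha> then \<one>\<^bsub>K\<^esub> else \<zero>\<^bsub>K\<^esub>)" for \<alpha>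
  have inj: "inj_on b (elts p)"
  proof (rule inj_onI)
    fix \<alpha> \<beta> assume \<alpha>: "\<alpha> \<in> elts p" and "b \<alpha> = b \<beta>"
    then have "b \<alpha> \<alpha> = b \<beta> \<alpha>" by simp
    then show "\<alpha> = \<beta>" using \<alpha> by (simp add: b_def split: if_splits)
  qed
  have b: "b ` elts p \<subseteq> carrier (pspace ?S 0)"
  proof (rule image_subsetI)
    fix \<alpha>
    have "b \<alpha> \<in> ?X" by (simp add: b_def)
    moreover have "finite {i \<in> elts p. b \<alpha> i \<noteq> \<zero>\<^bsub>K\<^esub>}"
      by (rule finite_subset[of _ "{\<alpha>}"]) (auto simp: b_def)
    ultimately show "b \<alpha> \<in> carrier (pspace ?S 0)"
      by (simp add: persmod_direct_sum_def vs_direct_sum_def interval_module_def)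
  qed
  have "inj_on e (b ` elts p)" using e(1) b sub by (meson inj_on_subset subset_trans)
  with inj have "inj_on (e \<circ> b) (elts p)" by (rule comp_inj_on)
  moreover have "(e \<circ> b) ` elts p \<subseteq> carrier (pspace M 0)" using b unfolding carrier by auto
  ultimately show ?thesis
    using pm id qt unfolding id_class_def qtame_class_def by blast
qed

section \<open>Proper classes of isomorphism classes\<close>

text \<open>
  Isomorphic modules have equinumerous spaces at each \<open>t\<close>, so a set of representatives bounds the
  size of the spaces at \<open>t\<close> throughout \<open>C\<close>; a module of \<open>C\<close> into whose space the power set of
  that bound injects contradicts Cantor's theorem.
\<close>
lemma (in zfc_universe) not_small_iso_classes:
  fixes C :: "('k, 'v) persmod set"
  assumes C: "C \<subseteq> pm_class elts K"
    and large: "\<And>p. \<exists>M\<in>C. \<exists>b. inj_on b (elts p) \<and> b ` elts p \<subseteq> carrier (pspace M t)"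
  shows "\<not> small elts (iso_classes K C)"
proof
  assume small: "small elts (iso_classes K C)"
  define r where "r = {(M, N). M \<in> C \<and> N \<in> C \<and> persmod_iso K M N}"
  define rep where "rep c = (SOME N :: ('k, 'v) persmod. N \<in> c)" for c
  define U where "U = (\<Union>c\<in>C // r. carrier (pspace (rep c) t))"
  have rep: "(M, rep (r `` {M})) \<in> r" if "M \<in> C" for M
  proof -
    have "persistence_module K M" using that C by (auto simp: pm_class_def)
    then have "(M, M) \<in> r" using that by (simp add: r_def persmod_iso_refl)
    then have "rep (r `` {M}) \<in> r `` {M}" unfolding rep_def some_in_eq by blast
    then show ?thesis by simp
  qed
  have "small elts (carrier (pspace (rep c) t))" if c: "c \<in> C // r" for c
  proof -
    obtain M where "M \<in> C" "c = r `` {M}" using c by (rule quotientE)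
    then have "rep c \<in> C" using rep[of M] by (simp add: r_def)
    then show ?thesis using C by (auto simp: pm_class_def)
  qed
  moreover have "small elts (C // r)" using small unfolding iso_classes_def r_def .
  ultimately have "small elts U" unfolding U_def by (rule small_UN[rotated])
  then obtain p where p: "\<And>f. inj_on f (elts p) \<Longrightarrow> \<not> f ` elts p \<subseteq> U"
    using ex_not_injecting_into_small by blast
  obtain M b where M: "M \<in> C" "inj_on b (elts p)" "b ` elts p \<subseteq> carrier (pspace M t)"
    using large by blast
  obtain \<phi> where \<phi>: "bij_betw \<phi> (carrier (pspace M t)) (carrier (pspace (rep (r `` {M})) t))"
    using rep[OF M(1)] unfolding r_def persmod_iso_def by blast
  have "carrier (pspace (rep (r `` {M})) t) \<subseteq> U"
    unfolding U_def using M(1) by (auto intro: quotientI)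
  then have "(\<phi> \<circ> b) ` elts p \<subseteq> U"
    using \<phi> M(3) unfolding bij_betw_def by auto
  moreover have "inj_on (\<phi> \<circ> b) (elts p)"
    using \<phi> M(2,3) unfolding bij_betw_def by (meson comp_inj_on inj_on_subset)
  ultimately show False using p by blast
qed

theorem corollary3p27:
  fixes elts :: "'v \<Rightarrow> 'v set" and K :: "'k ring"
  assumes "zfc_universe elts"
    and "field K" and "small elts (carrier K)"
  shows "\<not> small elts (iso_classes K (id_class elts K))
       \<and> \<not> small elts (iso_classes K (qtame_class elts K))
       \<and> \<not> small elts (iso_classes K (pm_class elts K))"
proof -
  interpret zfc_universe elts by fact
  have "\<not> small elts (iso_classes K C)"
    if "id_class elts K \<inter> qtame_class elts K \<subseteq> C" "C \<subseteq> pm_class elts K" for C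
    using that(2)
  proof (rule not_small_iso_classes)
    fix p
    show "\<exists>M\<in>C. \<exists>b. inj_on b (elts p) \<and> b ` elts p \<subseteq> carrier (pspace M 0)"
      using ex_skyscraper_module[OF assms(2,3), of p] that(1) by blast
  qed
  then show ?thesis unfolding id_class_def qtame_class_def by auto
qed

end
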